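(* Let $c(0)=1$ and $c(2m-1)=c(2m)=(-1)^mC_m$ for $m\ge1$, where $C_m$ are the Catalan numbers, so that $(c(n))_{n\ge0}=(1,-1,-1,2,2,-5,-5,\dots)$. Let $(\bar c(n))_{n\ge 0}=(c(0),0,c(1),0,c(2),0,\dots)$, i.e. $\bar c(2n)=c(n)$ and $\bar c(2n+1)=0$ for $n\ge 0$. Set $\bar d_0(n)=\det(\bar c(i+j))_{i,j=0}^{n-1}$ and $\bar d_1(n)=\det(\bar c(i+j+1))_{i,j=0}^{n-1}$. Then for all integers $n\ge 0$ $$\bar d_0(4n)=F_{2n+1}F_{2n+2},\quad \bar d_0(4n+1)=F_{2n+2}^2,\quad \bar d_0(4n+2)=-F_{2n+2}^2,\quad \bar d_0(4n+3)=F_{2n+2}F_{2n+3},$$ and $$\bar d_1(2n+1)=0,\quad \bar d_1(4n)=F_{2n+2}^2,\quad \bar d_1(4n+2)=-F_{2n+2}^2.$$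
   Context: $C_n=\frac{1}{n+1}\binom{2n}{n}$ is the $n$-th Catalan number. $F_n$ is the Fibonacci sequence $F_0=0$, $F_1=1$, $F_n=F_{n-1}+F_{n-2}$. The determinant of the empty ($0\times 0$) matrix is $1$. *)

theory Defs
  imports "HOL-Number_Theory.Fib" "Jordan_Normal_Form.Determinant"
begin

text \<open>The truncating division is exact, see \<open>of_nat_catalan\<close> below.\<close>

definition catalan :: "nat \<Rightarrow> nat" where
  "catalan n = ((2 * n) choose n) div (n + 1)"

lemma Suc_dvd_central_binomial: "n + 1 dvd (2 * n) choose n"
proof -
  have "Suc n * ((2 * n) choose Suc n) = n * ((2 * n) choose n)"
    using binomial_absorb_comp[of "2 * n" n] binomial_absorption[of n "2 * n"]
    by (metis add_diff_cancel_left' mult_2)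
  hence "n + 1 dvd n * ((2 * n) choose n)"
    by (metis Suc_eq_plus1 dvd_triv_left)
  thus ?thesis
    by (metis coprime_Suc_left_nat coprime_dvd_mult_right_iff Suc_eq_plus1)
qed

lemma of_nat_catalan:
  "(of_nat (catalan n) :: 'a :: field_char_0) = 1 / of_nat (n + 1) * of_nat ((2 * n) choose n)"
proof -
  have "(of_nat ((n + 1) * catalan n) :: 'a) = of_nat ((2 * n) choose n)"
    unfolding catalan_def by (subst dvd_mult_div_cancel[OF Suc_dvd_central_binomial]) simp
  moreover have "(of_nat (n + 1) :: 'a) \<noteq> 0"
    by (metis of_nat_eq_0_iff Suc_eq_plus1 nat.distinct(1))
  ultimately show ?thesis
    unfolding of_nat_mult by (metis nonzero_mult_div_cancel_left times_divide_eq_left mult_1)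
qed

text \<open>For \<open>m \<ge> 1\<close>, both \<open>n = 2 * m - 1\<close> and \<open>n = 2 * m\<close> have \<open>(n + 1) div 2 = m\<close>.\<close>

definition c :: "nat \<Rightarrow> int" where
  "c n = (if n = 0 then 1 else (-1) ^ ((n + 1) div 2) * int (catalan ((n + 1) div 2)))"

lemma c_0: "c 0 = 1"
  by (simp add: c_def)

lemma c_odd_even:
  assumes "m \<ge> 1"
  shows "c (2 * m - 1) = (-1) ^ m * int (catalan m)" "c (2 * m) = (-1) ^ m * int (catalan m)"
  using assms by (auto simp: c_def)

definition c_bar :: "nat \<Rightarrow> int" where
  "c_bar n = (if even n then c (n div 2) else 0)"

definition d0_bar :: "nat \<Rightarrow> int" where
  "d0_bar n = det (mat n n (\<lambda>(i, j). c_bar (i + j)))"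

definition d1_bar :: "nat \<Rightarrow> int" where
  "d1_bar n = det (mat n n (\<lambda>(i, j). c_bar (i + j + 1)))"

end

theory Submission
  imports Defs
begin

text \<open>Let \<open>a(2m) = (-1)^m C\<^sub>m\<close> and \<open>a(2m+1) = 0\<close>. These are the moments of the functional for
  which the polynomials \<open>p\<^sub>k\<^sub>+\<^sub>2 = x p\<^sub>k\<^sub>+\<^sub>1 + p\<^sub>k\<close> are orthogonal, and \<open>c(n) = a(n) + a(n+1)\<close> are the
  moments of this functional multiplied by \<open>1 + x\<close>. Christoffel's formula then gives polynomials
  \<open>P\<^sub>k\<close> and \<open>Q\<^sub>k\<close>, orthogonal with respect to the weights \<open>1 + x\<close> and \<open>x (1 + x)\<close>, as explicit
  combinations of the \<open>p\<^sub>k\<close> whose coefficients are the Fibonacci numbers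
  \<open>\<bar>p\<^sub>k(-1)\<bar>\<close>. Consequently \<open>P\<^sub>m(x\<^sup>2)\<close> and \<open>x Q\<^sub>m(x\<^sup>2)\<close> are orthogonal for the moments
  \<open>c_bar\<close> and triangularise the first Hankel matrix, while \<open>Q\<^sub>m(x\<^sup>2)\<close> and \<open>x Q\<^sub>m(x\<^sup>2)\<close> bring the
  shifted one to block triangular form with antidiagonal blocks of size 2. The polynomials are scaled
  to have integer coefficients, so the product of their leading coefficients has to be cancelled.\<close>

section \<open>Moments of polynomials and Hankel determinants\<close>

definition moment :: "(nat \<Rightarrow> 'a::comm_ring_1) \<Rightarrow> 'a poly \<Rightarrow> nat \<Rightarrow> 'a" where
  "moment s f i = (\<Sum>k\<le>degree f. coeff f k * s (i + k))"

lemma moment_eq_sum: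
  assumes "degree f \<le> N"
  shows "moment s f i = (\<Sum>k\<le>N. coeff f k * s (i + k))"
  unfolding moment_def using assms
  by (intro sum.mono_neutral_left) (auto simp: coeff_eq_0)

lemma moment_0 [simp]: "moment s 0 i = 0"
  by (simp add: moment_def)

lemma moment_1 [simp]: "moment s 1 i = s i"
  by (simp add: moment_def)

lemma moment_add: "moment s (f + g) i = moment s f i + moment s g i"
proof -
  define N where "N = max (degree f) (degree g)"
  have "degree (f + g) \<le> N" "degree f \<le> N" "degree g \<le> N"
    using degree_add_le_max[of f g] by (auto simp: N_def)
  then show ?thesis
    by (simp add: moment_eq_sum[where N = N] sum.distrib algebra_simps)
qed

lemma moment_smult: "moment s (smult a f) i = a * moment s f i"
  by (subst moment_eq_sum[OF degree_smult_le])
    (simp add: moment_def sum_distrib_left mult.assoc)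

lemma moment_diff: "moment s (f - g) i = moment s f i - moment s g i"
proof -
  have "f - g = f + smult (-1) g" by simp
  then show ?thesis by (simp only: moment_add moment_smult) simp
qed

lemma moment_pCons: "moment s (pCons a f) i = a * s i + moment s f (Suc i)"
  by (subst moment_eq_sum[OF degree_pCons_le])
    (simp add: moment_def sum.atMost_Suc_shift del: sum.atMost_Suc)

lemma moment_shift: "moment (\<lambda>n. s (Suc n)) f i = moment s f (Suc i)"
  by (simp add: moment_def)

lemma moment_add_seq: "moment (\<lambda>n. s n + t n) f i = moment s f i + moment t f i"
  by (simp add: moment_def sum.distrib algebra_simps)

text \<open>Multiplying the Hankel matrix by the upper triangular coefficient matrix of the
  \<open>g j\<close> produces the moments. Keeping the leading coefficients as a factor avoids
  division.\<close>

lemma det_hankel_times_lead_coeffs: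
  fixes s :: "nat \<Rightarrow> 'a::comm_ring_1"
  assumes "\<And>j. j < n \<Longrightarrow> degree (g j) \<le> j"
  shows "det (mat n n (\<lambda>(i, j). s (i + j))) * (\<Prod>j<n. coeff (g j) j) =
    det (mat n n (\<lambda>(i, j). moment s (g j) i))"
proof -
  define G where "G = mat n n (\<lambda>(k, j). coeff (g j) k)"
  have "upper_triangular G"
  proof
    fix i j assume "j < i" "i < dim_row G"
    then have "j < i" "i < n" by (simp_all add: G_def)
    moreover from this have "degree (g j) < i" using assms[of j] by simp
    ultimately show "G $$ (i, j) = 0" by (simp add: G_def coeff_eq_0)
  qed
  then have "det G = (\<Prod>j<n. coeff (g j) j)"
    by (subst det_upper_triangular[of _ n])
      (auto simp: G_def diag_mat_def prod.list_conv_set_nth atLeast0LessThan)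
  moreover have "mat n n (\<lambda>(i, j). s (i + j)) * G = mat n n (\<lambda>(i, j). moment s (g j) i)"
  proof (rule eq_matI)
    fix i j assume "i < dim_row (mat n n (\<lambda>(i, j). moment s (g j) i))"
      "j < dim_col (mat n n (\<lambda>(i, j). moment s (g j) i))"
    then have ij: "i < n" "j < n" by auto
    have "degree (g j) \<le> n - 1" using assms[OF ij(2)] ij by simp
    moreover have "{..n - 1} = {0..<n}" using ij by auto
    ultimately show "(mat n n (\<lambda>(i, j). s (i + j)) * G) $$ (i, j) =
        mat n n (\<lambda>(i, j). moment s (g j) i) $$ (i, j)"
      using ij by (simp add: G_def scalar_prod_def moment_eq_sum[where N = "n - 1"] mult.commute)
  qed (auto simp: G_def)
  ultimately show ?thesis
    using det_mult[of "mat n n (\<lambda>(i, j). s (i + j))" n G] by (simp add: G_def)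
qed

lemma det_mat_lower_triangular:
  fixes f :: "nat \<Rightarrow> nat \<Rightarrow> 'a::comm_ring_1"
  assumes "\<And>i j. i < j \<Longrightarrow> j < n \<Longrightarrow> f i j = 0"
  shows "det (mat n n (\<lambda>(i, j). f i j)) = (\<Prod>j<n. f j j)"
  by (subst det_lower_triangular[of n])
    (auto simp: assms diag_mat_def prod.list_conv_set_nth atLeast0LessThan)

lemma det_mat_2: "det (mat 2 2 f) = f (0, 0) * f (1, 1) - f (0, 1) * f (1, 0)"
proof -
  let ?A = "mat 2 2 f"
  have "det ?A = (\<Sum>i<2. ?A $$ (i, 0) * cofactor ?A i 0)"
    by (rule laplace_expansion_column) auto
  also have "\<dots> = ?A $$ (0, 0) * cofactor ?A 0 0 + ?A $$ (1, 0) * cofactor ?A 1 0"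
    by (simp add: numeral_2_eq_2)
  also have "cofactor ?A 0 0 = f (1, 1)"
    unfolding cofactor_def by (subst det_single) (auto simp: mat_delete_def)
  also have "cofactor ?A 1 0 = - f (0, 1)"
    unfolding cofactor_def by (subst det_single) (auto simp: mat_delete_def)
  finally show ?thesis by simp
qed

text \<open>Induction on the number of blocks, splitting off the last one.\<close>

lemma det_mat_block_lower_triangular:
  fixes f :: "nat \<Rightarrow> nat \<Rightarrow> 'a::idom"
  assumes "\<And>i j. i div 2 < j div 2 \<Longrightarrow> f i j = 0"
  shows "det (mat (2 * k) (2 * k) (\<lambda>(i, j). f i j)) =
    (\<Prod>m<k. f (2 * m) (2 * m) * f (2 * m + 1) (2 * m + 1)
          - f (2 * m) (2 * m + 1) * f (2 * m + 1) (2 * m))"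
proof (induction k)
  case 0
  then show ?case by (simp add: det_dim_zero)
next
  case (Suc k)
  let ?A = "mat (2 * k) (2 * k) (\<lambda>(i, j). f i j)"
  let ?C = "mat 2 (2 * k) (\<lambda>(i, j). f (2 * k + i) j)"
  let ?D = "mat 2 2 (\<lambda>(i, j). f (2 * k + i) (2 * k + j))"
  have zero: "f i j = 0" if "i < 2 * k" "2 * k \<le> j" for i j
    by (rule assms) (use that in presburger)
  have "mat (2 * Suc k) (2 * Suc k) (\<lambda>(i, j). f i j) =
      four_block_mat ?A (0\<^sub>m (2 * k) 2) ?C ?D"
    by (rule eq_matI) (auto simp: zero)
  then have "det (mat (2 * Suc k) (2 * Suc k) (\<lambda>(i, j). f i j)) =
      det (four_block_mat ?A (0\<^sub>m (2 * k) 2) ?C ?D)"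
    by (rule arg_cong)
  also have "\<dots> = det ?A * det ?D"
    by (rule det_four_block_mat_upper_right_zero) auto
  finally show ?case
    unfolding Suc.IH det_mat_2 prod.lessThan_Suc by (simp only: split_conv add_0_right)
qed

section \<open>Aerated Catalan numbers and Fibonacci polynomials\<close>

definition aerated_catalan :: "nat \<Rightarrow> int" where
  "aerated_catalan n = (if even n then (-1) ^ (n div 2) * int (catalan (n div 2)) else 0)"

text \<open>Exactly one of \<open>n\<close> and \<open>n + 1\<close> is even, so one summand always
  vanishes.\<close>

lemma c_eq_aerated_catalan: "c n = aerated_catalan n + aerated_catalan (Suc n)"
proof (cases "even n")
  case True
  then obtain m where "n = 2 * m" by (rule evenE)
  then show ?thesis by (cases "m = 0") (simp_all add: c_def aerated_catalan_def catalan_def)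
next
  case False
  then obtain m where "n = 2 * m + 1" by (rule oddE)
  then show ?thesis by (simp add: c_def aerated_catalan_def)
qed

text \<open>The Fibonacci polynomials, with the index shifted by one so that \<open>fib_poly k\<close> has degree \<open>k\<close>.\<close>

fun fib_poly :: "nat \<Rightarrow> int poly" where
  "fib_poly 0 = 1"
| "fib_poly (Suc 0) = [:0, 1:]"
| "fib_poly (Suc (Suc k)) = pCons 0 (fib_poly (Suc k)) + fib_poly k"

lemma degree_lead_fib_poly: "degree (fib_poly k) = k \<and> coeff (fib_poly k) k = 1"
proof (induction k rule: fib_poly.induct)
  case (3 k)
  then have "fib_poly (Suc k) \<noteq> 0" by auto
  with 3 show ?case by (simp add: degree_add_eq_left coeff_eq_0)
qed auto

lemma degree_fib_poly [simp]: "degree (fib_poly k) = k"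
  and lead_coeff_fib_poly [simp]: "coeff (fib_poly k) k = 1"
  using degree_lead_fib_poly by auto

lemma coeff_0_fib_poly: "coeff (fib_poly k) 0 = (if even k then 1 else 0)"
  by (induction k rule: fib_poly.induct) auto

text \<open>The case distinction avoids the truncated \<open>m - 1\<close> for \<open>m = 0\<close>.\<close>

definition ballot :: "nat \<Rightarrow> nat \<Rightarrow> int" where
  "ballot k m = int ((k + 2 * m) choose m) - (if m = 0 then 0 else int ((k + 2 * m) choose (m - 1)))"

lemma ballot_0 [simp]: "ballot k 0 = 1"
  by (simp add: ballot_def)

text \<open>Pascal's rule. Up to sign this is the recursion that \<open>fib_poly\<close> imposes on
  its moments.\<close>

lemma ballot_Suc: "ballot (Suc (Suc k)) m = ballot (Suc k) (Suc m) - ballot k (Suc m)"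
  by (cases m) (auto simp: ballot_def)

lemma catalan_eq_ballot: "int (catalan m) = ballot 0 m"
proof (cases m)
  case 0
  then show ?thesis by (simp add: catalan_def)
next
  case (Suc l)
  define B where "B = (2 * m) choose m"
  have "m * B = (m + 1) * ((2 * m) choose l)"
    using binomial_absorb_comp[of "2 * m" l] binomial_absorption[of l "2 * m"] Suc
    by (simp add: B_def algebra_simps)
  then have "(m + 1) * (B - ((2 * m) choose l)) = B"
    by (simp add: diff_mult_distrib2)
  moreover have "(m + 1) * catalan m = B"
    unfolding catalan_def B_def by (rule dvd_mult_div_cancel[OF Suc_dvd_central_binomial])
  ultimately have "catalan m = B - ((2 * m) choose l)"
    by (metis add_is_0 mult_cancel1 one_neq_zero)
  \<comment> \<open>Makes the natural-number difference a genuine one after the cast to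
    integers.\<close>
  moreover have "(2 * m) choose l \<le> B"
    unfolding B_def by (rule binomial_mono) (use Suc in auto)
  ultimately show ?thesis using Suc by (simp add: ballot_def B_def)
qed

lemma ballot_1: "ballot (Suc 0) m = ballot 0 (Suc m)"
proof -
  have "Suc (2 * m) choose Suc m = Suc (2 * m) choose m"
    using binomial_symmetric[of m "Suc (2 * m)"] by simp
  then show ?thesis by (cases m) (auto simp: ballot_def)
qed

lemma moment_fib_poly_odd:
  "odd (k + j) \<Longrightarrow> moment aerated_catalan (fib_poly k) j = 0"
  by (induction k arbitrary: j rule: fib_poly.induct)
    (auto simp: moment_pCons moment_add aerated_catalan_def)

text \<open>The case \<open>m = 0\<close> gives the diagonal moments; general \<open>m\<close> is
  needed because each use of the recurrence raises \<open>m\<close> by one.\<close>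

lemma moment_fib_poly_ballot:
  "moment aerated_catalan (fib_poly k) (k + 2 * m) = (-1) ^ (k + m) * ballot k m"
proof (induction k arbitrary: m rule: fib_poly.induct)
  case 1
  then show ?case by (simp add: aerated_catalan_def catalan_eq_ballot)
next
  case 2
  then show ?case by (simp add: moment_pCons aerated_catalan_def catalan_eq_ballot ballot_1)
next
  case (3 k)
  show ?case using "3.IH"(1)[of "Suc m"] "3.IH"(2)[of "Suc m"]
    by (simp add: moment_pCons moment_add ballot_Suc algebra_simps)
qed

lemma moment_fib_poly_diag: "moment aerated_catalan (fib_poly k) k = (-1) ^ k"
  using moment_fib_poly_ballot[of k 0] by simp

text \<open>In the step to \<open>k + 2\<close>, both terms of the recurrence vanish by induction
  for \<open>j < k\<close>, cancel by opposite signs at \<open>j = k\<close>, and vanish by parity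
  at \<open>j = k + 1\<close>.\<close>

lemma moment_fib_poly_less:
  "j < k \<Longrightarrow> moment aerated_catalan (fib_poly k) j = 0"
proof (induction k arbitrary: j rule: fib_poly.induct)
  case 2
  then show ?case by (simp add: moment_pCons aerated_catalan_def)
next
  case (3 k)
  consider "j < k" | "j = k" | "j = Suc k" using "3.prems" by linarith
  then show ?case
  proof cases
    case 2
    then show ?thesis
      using moment_fib_poly_diag[of k] moment_fib_poly_diag[of "Suc k"]
      by (simp add: moment_pCons moment_add)
  qed (use "3.IH" in \<open>auto simp: moment_pCons moment_add moment_fib_poly_odd\<close>)
qed auto

section \<open>Orthogonal polynomials for the weights \<open>1 + x\<close> and
  \<open>x (1 + x)\<close>\<close>

lemma moment_c: "moment c f i = moment aerated_catalan f i + moment aerated_catalan f (Suc i)"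
proof -
  have "moment c f i = moment (\<lambda>n. aerated_catalan n + aerated_catalan (Suc n)) f i"
    by (simp add: moment_def c_eq_aerated_catalan)
  then show ?thesis by (simp only: moment_add_seq moment_shift)
qed

text \<open>The recurrence read as \<open>x p = fib_poly (k + 2) - fib_poly k\<close> for
  \<open>p = fib_poly (k + 1)\<close>.\<close>

lemma moment_c_fib_poly_Suc:
  "moment c (fib_poly (Suc k)) j = moment aerated_catalan (fib_poly (Suc (Suc k))) j +
     moment aerated_catalan (fib_poly (Suc k)) j - moment aerated_catalan (fib_poly k) j"
  by (simp add: moment_c moment_pCons moment_add)

text \<open>Up to scaling, \<open>kernel_poly k\<close> is the Christoffel-Darboux kernel of the polynomials
  \<^const>\<open>fib_poly\<close> at the point \<open>-1\<close>, where \<open>fib_poly i\<close> takes the value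
  \<open>(-1) ^ i * fib (i + 1)\<close>. Hence \<open>(1 + x) * kernel_poly k\<close> only involves \<open>fib_poly k\<close> and
  \<open>fib_poly (k + 1)\<close>.\<close>

definition kernel_poly :: "nat \<Rightarrow> int poly" where
  "kernel_poly k = (\<Sum>i\<le>k. smult (int (fib (Suc i))) (fib_poly i))"

lemma kernel_poly_0: "kernel_poly 0 = 1"
  by (simp add: kernel_poly_def)

lemma kernel_poly_Suc:
  "kernel_poly (Suc k) = kernel_poly k + smult (int (fib (Suc (Suc k)))) (fib_poly (Suc k))"
  by (simp add: kernel_poly_def)

lemma degree_kernel_poly_le: "degree (kernel_poly k) \<le> k"
  unfolding kernel_poly_def
  by (intro degree_sum_le) (auto intro: order_trans[OF degree_smult_le])

lemma lead_coeff_kernel_poly: "coeff (kernel_poly k) k = int (fib (Suc k))"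
proof (cases k)
  case (Suc l)
  then show ?thesis
    using degree_kernel_poly_le[of l] by (simp add: kernel_poly_Suc coeff_eq_0 del: fib_poly.simps)
qed (simp add: kernel_poly_0)

text \<open>Only the even-indexed \<open>fib_poly\<close> contribute, leaving a sum of odd-indexed
  Fibonacci numbers.\<close>

lemma coeff_0_kernel_poly:
  "coeff (kernel_poly k) 0 = int (fib (if even k then Suc (Suc k) else Suc k))"
  by (induction k) (auto simp: kernel_poly_0 kernel_poly_Suc coeff_0_fib_poly simp del: fib_poly.simps)

text \<open>The sum of the moments of \<open>(1 + x) * fib_poly i\<close> telescopes by the
  Fibonacci recurrence.\<close>

lemma moment_kernel_poly:
  "moment c (kernel_poly k) j =
     int (fib (Suc k)) * moment aerated_catalan (fib_poly (Suc k)) j +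
     int (fib (Suc (Suc k))) * moment aerated_catalan (fib_poly k) j"
proof (induction k)
  case 0
  show ?case by (simp add: kernel_poly_0 moment_pCons c_eq_aerated_catalan)
next
  case (Suc k)
  have "fib (Suc (Suc (Suc k))) = fib (Suc (Suc k)) + fib (Suc k)" by simp
  with Suc show ?case
    by (simp add: kernel_poly_Suc moment_add moment_smult moment_c_fib_poly_Suc algebra_simps
        del: fib_poly.simps fib.simps)
qed

lemma moment_kernel_poly_less: "j < k \<Longrightarrow> moment c (kernel_poly k) j = 0"
  by (simp add: moment_kernel_poly moment_fib_poly_less del: fib_poly.simps)

lemma moment_kernel_poly_diag: "moment c (kernel_poly k) k = (-1) ^ k * int (fib (k + 2))"
  by (simp add: moment_kernel_poly moment_fib_poly_less moment_fib_poly_diag del: fib_poly.simps)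

text \<open>Up to scaling, this is the combination of \<open>kernel_poly k\<close> and \<open>kernel_poly (k + 1)\<close> that
  vanishes at \<open>0\<close>, so that its quotient by \<open>x\<close> is orthogonal with respect to \<open>\<lambda>n. c (n + 1)\<close>.\<close>

definition kernel_combination :: "nat \<Rightarrow> int poly" where
  "kernel_combination k = (if even k then fib_poly (Suc k)
     else smult (int (fib (Suc k))) (fib_poly (Suc k)) - kernel_poly k)"

definition shifted_poly :: "nat \<Rightarrow> int poly" where
  "shifted_poly k = poly_shift 1 (kernel_combination k)"

text \<open>Division by \<open>x\<close> is exact: for even \<open>k\<close> by parity, for odd
  \<open>k\<close> because both terms have constant coefficient \<open>fib (k + 1)\<close>.\<close>

lemma pCons_shifted_poly: "pCons 0 (shifted_poly k) = kernel_combination k"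
proof (rule poly_eqI)
  fix n
  have "coeff (kernel_combination k) 0 = 0"
    by (simp add: kernel_combination_def coeff_0_fib_poly coeff_0_kernel_poly del: fib_poly.simps)
  then show "coeff (pCons 0 (shifted_poly k)) n = coeff (kernel_combination k) n"
    by (cases n) (simp_all add: shifted_poly_def coeff_poly_shift)
qed

lemma degree_shifted_poly_le: "degree (shifted_poly k) \<le> k"
proof (rule degree_le, intro allI impI)
  fix i assume "k < i"
  then show "coeff (shifted_poly k) i = 0"
    using degree_kernel_poly_le[of k]
    by (simp add: shifted_poly_def coeff_poly_shift kernel_combination_def coeff_eq_0
        del: fib_poly.simps)
qed

lemma lead_coeff_shifted_poly:
  "coeff (shifted_poly k) k = (if even k then 1 else int (fib (Suc k)))"
  using degree_kernel_poly_le[of k]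
  by (simp add: shifted_poly_def coeff_poly_shift kernel_combination_def coeff_eq_0
      del: fib_poly.simps)

text \<open>For odd \<open>k\<close>, subtracting \<open>kernel_poly k\<close> removes the
  \<open>fib_poly (k + 1)\<close> term.\<close>

lemma moment_shifted_poly:
  "moment c (shifted_poly k) (Suc j) =
     (if even k then moment aerated_catalan (fib_poly (Suc (Suc k))) j +
        moment aerated_catalan (fib_poly (Suc k)) j - moment aerated_catalan (fib_poly k) j
      else int (fib (Suc k)) * moment aerated_catalan (fib_poly (Suc (Suc k))) j -
        int (fib (k + 3)) * moment aerated_catalan (fib_poly k) j)"
proof -
  have "fib (k + 3) = fib (Suc (Suc k)) + fib (Suc k)" by (simp add: numeral_3_eq_3)
  moreover have "moment c (shifted_poly k) (Suc j) = moment c (kernel_combination k) j"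
    by (simp add: moment_pCons flip: pCons_shifted_poly)
  ultimately show ?thesis
    by (simp add: kernel_combination_def moment_diff moment_smult moment_kernel_poly
        moment_c_fib_poly_Suc algebra_simps del: fib_poly.simps fib.simps)
qed

lemma moment_shifted_poly_less: "j < k \<Longrightarrow> moment c (shifted_poly k) (Suc j) = 0"
  by (simp add: moment_shifted_poly moment_fib_poly_less del: fib_poly.simps)

lemma moment_shifted_poly_diag:
  "moment c (shifted_poly k) (Suc k) = (if even k then - 1 else int (fib (k + 3)))"
  by (simp add: moment_shifted_poly moment_fib_poly_less moment_fib_poly_diag del: fib_poly.simps)

section \<open>Substitution of the square and bases for \<open>c_bar\<close>\<close>

abbreviation at_square :: "int poly \<Rightarrow> int poly" where
  "at_square f \<equiv> pcompose f [:0, 0, 1:]"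

lemma at_square_pCons: "at_square (pCons a f) = pCons a (pCons 0 (at_square f))"
  by (simp add: pcompose_pCons)

lemma coeff_at_square: "coeff (at_square f) (2 * k) = coeff f k"
proof (induction f arbitrary: k)
  case (pCons a f)
  then show ?case by (cases k) (auto simp: at_square_pCons)
qed simp

lemma degree_at_square_le: "degree (at_square f) \<le> 2 * degree f"
  using degree_pcompose_le[of f "[:0, 0, 1:]"] by simp

lemma moment_c_bar_at_square:
  "moment c_bar (at_square f) i = (if even i then moment c f (i div 2) else 0)"
proof (induction f arbitrary: i)
  case (pCons a f)
  then show ?case by (simp add: at_square_pCons moment_pCons c_bar_def)
qed simp

definition basis0 :: "nat \<Rightarrow> int poly" where
  "basis0 j = (if even j then at_square (kernel_poly (j div 2))
     else pCons 0 (at_square (shifted_poly (j div 2))))"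

definition basis1 :: "nat \<Rightarrow> int poly" where
  "basis1 j = (if even j then at_square (shifted_poly (j div 2))
     else pCons 0 (at_square (shifted_poly (j div 2))))"

lemma degree_at_square_half_le:
  assumes "degree f \<le> j div 2"
  shows "even j \<Longrightarrow> degree (at_square f) \<le> j"
    and "odd j \<Longrightarrow> degree (pCons 0 (at_square f)) \<le> j"
proof -
  have *: "degree (at_square f) \<le> 2 * (j div 2)"
    using degree_at_square_le[of f] assms by linarith
  show "even j \<Longrightarrow> degree (at_square f) \<le> j" using * by simp
  show "odd j \<Longrightarrow> degree (pCons 0 (at_square f)) \<le> j"
    using * degree_pCons_le[of 0 "at_square f"] odd_two_times_div_two_succ[of j] by linarith
qed

lemma degree_basis0_le: "degree (basis0 j) \<le> j"
  unfolding basis0_def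
  using degree_at_square_half_le[OF degree_kernel_poly_le]
    degree_at_square_half_le[OF degree_shifted_poly_le] by auto

lemma degree_basis1_le: "degree (basis1 j) \<le> j"
  unfolding basis1_def
  using degree_at_square_half_le[OF degree_shifted_poly_le] by auto

lemma coeff_basis0:
  "coeff (basis0 (2 * m)) (2 * m) = int (fib (m + 1))"
  "coeff (basis0 (2 * m + 1)) (2 * m + 1) = (if even m then 1 else int (fib (m + 1)))"
  by (simp_all add: basis0_def coeff_at_square lead_coeff_kernel_poly lead_coeff_shifted_poly)

lemma coeff_basis1:
  "coeff (basis1 (2 * m)) (2 * m) = (if even m then 1 else int (fib (m + 1)))"
  "coeff (basis1 (2 * m + 1)) (2 * m + 1) = (if even m then 1 else int (fib (m + 1)))"
  by (simp_all add: basis1_def coeff_at_square lead_coeff_shifted_poly)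

lemma moment_basis0:
  "moment c_bar (basis0 j) i =
    (if even i \<noteq> even j then 0
     else if even j then moment c (kernel_poly (j div 2)) (i div 2)
     else moment c (shifted_poly (j div 2)) (Suc (i div 2)))"
  by (auto simp: basis0_def moment_pCons moment_c_bar_at_square elim!: oddE)

text \<open>The index \<open>Suc (i div 2)\<close> is half of \<open>i + 1\<close> for odd
  \<open>i\<close>, and half of \<open>i + 2\<close> for even \<open>i\<close>, where the factor
  \<open>x\<close> of an odd \<open>j\<close> adds one.\<close>

lemma moment_basis1:
  "moment c_bar (basis1 j) (Suc i) =
    (if even i = even j then 0 else moment c (shifted_poly (j div 2)) (Suc (i div 2)))"
  by (auto simp: basis1_def moment_pCons moment_c_bar_at_square elim!: oddE)

lemma moment_basis0_less:
  assumes "i < j"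
  shows "moment c_bar (basis0 j) i = 0"
proof (cases "even i = even j")
  case True
  with assms have "i div 2 < j div 2" by presburger
  then show ?thesis
    by (simp add: moment_basis0 moment_kernel_poly_less moment_shifted_poly_less)
qed (simp add: moment_basis0)

lemma moment_basis0_diag:
  "moment c_bar (basis0 (2 * m)) (2 * m) = (-1) ^ m * int (fib (m + 2))"
  "moment c_bar (basis0 (2 * m + 1)) (2 * m + 1) = (if even m then - 1 else int (fib (m + 3)))"
  by (simp_all add: moment_basis0 moment_kernel_poly_diag moment_shifted_poly_diag)

lemma moment_basis1_less:
  "i div 2 < j div 2 \<Longrightarrow> moment c_bar (basis1 j) (Suc i) = 0"
  by (simp add: moment_basis1 moment_shifted_poly_less)

section \<open>Recurrences for the determinants\<close>

lemma fib_Suc_neq_0: "fib (Suc n) \<noteq> 0"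
  using fib_neq_0_nat[of "Suc n"] by simp

lemma prod_coeff_basis_neq_0:
  "(\<Prod>j<n. coeff (basis0 j) j) \<noteq> 0" "(\<Prod>j<n. coeff (basis1 j) j) \<noteq> 0"
proof -
  have "coeff (basis0 j) j \<noteq> 0 \<and> coeff (basis1 j) j \<noteq> 0" for j
  proof (cases "even j")
    case True
    then obtain m where "j = 2 * m" by (rule evenE)
    then show ?thesis using coeff_basis0(1)[of m] coeff_basis1(1)[of m] fib_Suc_neq_0[of m] by simp
  next
    case False
    then obtain m where "j = 2 * m + 1" by (rule oddE)
    then show ?thesis using coeff_basis0(2)[of m] coeff_basis1(2)[of m] fib_Suc_neq_0[of m] by simp
  qed
  then show "(\<Prod>j<n. coeff (basis0 j) j) \<noteq> 0" "(\<Prod>j<n. coeff (basis1 j) j) \<noteq> 0" by simp_all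
qed

lemma d0_bar_times_lead_coeffs:
  "d0_bar n * (\<Prod>j<n. coeff (basis0 j) j) = (\<Prod>j<n. moment c_bar (basis0 j) j)"
  unfolding d0_bar_def
  by (simp add: det_hankel_times_lead_coeffs degree_basis0_le
      det_mat_lower_triangular moment_basis0_less)

lemma d0_bar_0: "d0_bar 0 = 1"
  by (simp add: d0_bar_def det_dim_zero)

text \<open>Compares the product formulas for \<open>n\<close> and \<open>n + 1\<close> and cancels
  their common nonzero product of leading coefficients.\<close>

lemma d0_bar_Suc:
  "d0_bar (Suc n) * coeff (basis0 n) n = d0_bar n * moment c_bar (basis0 n) n"
proof -
  let ?W = "\<Prod>j<n. coeff (basis0 j) j"
  have "(d0_bar (Suc n) * coeff (basis0 n) n) * ?W =
      d0_bar (Suc n) * (\<Prod>j<Suc n. coeff (basis0 j) j)"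
    by (simp only: prod.lessThan_Suc mult_ac)
  also have "\<dots> = (d0_bar n * ?W) * moment c_bar (basis0 n) n"
    by (simp only: d0_bar_times_lead_coeffs) simp
  finally have "(d0_bar (Suc n) * coeff (basis0 n) n) * ?W =
      (d0_bar n * moment c_bar (basis0 n) n) * ?W"
    by (simp only: mult_ac)
  then show ?thesis by (rule mult_right_cancel[OF prod_coeff_basis_neq_0(1), THEN iffD1])
qed

lemma d1_bar_times_lead_coeffs:
  "d1_bar n * (\<Prod>j<n. coeff (basis1 j) j) =
    det (mat n n (\<lambda>(i, j). moment c_bar (basis1 j) (Suc i)))"
  using det_hankel_times_lead_coeffs[of n basis1 "\<lambda>n. c_bar (Suc n)"]
  by (simp add: d1_bar_def degree_basis1_le moment_shift)

lemma d1_bar_0: "d1_bar 0 = 1"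
  by (simp add: d1_bar_def det_dim_zero)

text \<open>In each block parity kills the diagonal, and the two antidiagonal entries
  coincide.\<close>

lemma d1_bar_even:
  "d1_bar (2 * k) * (\<Prod>j<2 * k. coeff (basis1 j) j) =
    (\<Prod>m<k. - (moment c (shifted_poly m) (Suc m))\<^sup>2)"
  by (simp add: d1_bar_times_lead_coeffs det_mat_block_lower_triangular moment_basis1_less)
    (simp add: moment_basis1 power2_eq_square)

lemma d1_bar_even_Suc:
  "d1_bar (2 * Suc k) * (coeff (shifted_poly k) k)\<^sup>2 =
    - d1_bar (2 * k) * (moment c (shifted_poly k) (Suc k))\<^sup>2"
proof -
  let ?W = "\<Prod>j<2 * k. coeff (basis1 j) j" and ?v = "moment c (shifted_poly k) (Suc k)"
  have "(d1_bar (2 * Suc k) * (coeff (shifted_poly k) k)\<^sup>2) * ?W =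
      d1_bar (2 * Suc k) * (\<Prod>j<2 * Suc k. coeff (basis1 j) j)"
    using coeff_basis1[of k] by (simp add: lead_coeff_shifted_poly power2_eq_square)
  also have "\<dots> = (d1_bar (2 * k) * ?W) * (- ?v\<^sup>2)"
    by (simp only: d1_bar_even prod.lessThan_Suc)
  finally have "(d1_bar (2 * Suc k) * (coeff (shifted_poly k) k)\<^sup>2) * ?W =
      (- d1_bar (2 * k) * ?v\<^sup>2) * ?W"
    by (simp only: mult_ac mult_minus_left mult_minus_right)
  then show ?thesis by (rule mult_right_cancel[OF prod_coeff_basis_neq_0(2), THEN iffD1])
qed

text \<open>The last column is zero: even rows vanish by parity, odd rows lie in earlier
  blocks.\<close>

lemma d1_bar_odd: "d1_bar (2 * k + 1) = 0"
proof -
  let ?A = "mat (2 * k + 1) (2 * k + 1) (\<lambda>(i, j). moment c_bar (basis1 j) (Suc i))"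
  have "?A $$ (i, 2 * k) = 0" if "i < 2 * k + 1" for i
  proof (cases "even i")
    case True
    with that show ?thesis by (simp add: moment_basis1)
  next
    case False
    with that have "i div 2 < k" by presburger
    with that show ?thesis by (simp add: moment_basis1_less)
  qed
  then have "det ?A = 0"
    by (subst laplace_expansion_column[of _ "2 * k + 1" "2 * k"]) auto
  then show ?thesis
    using d1_bar_times_lead_coeffs[of "2 * k + 1"] prod_coeff_basis_neq_0(2)[of "2 * k + 1"] by simp
qed

section \<open>Evaluation by residues modulo 4\<close>

lemma index_simps:
  fixes n :: nat
  shows "4 * Suc n = 4 * n + 4" "2 * Suc n + 1 = 2 * n + 3" "2 * Suc n + 2 = 2 * n + 4"
    "2 * (2 * n) = 4 * n" "2 * (2 * n + 1) = 4 * n + 2" "2 * Suc (2 * n) = 4 * n + 2"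
    "2 * Suc (2 * n + 1) = 4 * n + 4" "4 * n + 2 + 1 = 4 * n + 3" "4 * n + 2 + 2 = 4 * n + 4"
    "2 * n + 1 + 1 = 2 * n + 2" "2 * n + 1 + 2 = 2 * n + 3" "2 * n + 1 + 3 = 2 * n + 4"
  by simp_all

lemma d0_bar_step_even:
  "d0_bar (2 * m + 1) * int (fib (m + 1)) = d0_bar (2 * m) * ((-1) ^ m * int (fib (m + 2)))"
  using d0_bar_Suc[of "2 * m"] unfolding coeff_basis0 moment_basis0_diag by (simp only: Suc_eq_plus1)

lemma d0_bar_step_odd:
  "d0_bar (2 * m + 2) * (if even m then 1 else int (fib (m + 1))) =
    d0_bar (2 * m + 1) * (if even m then - 1 else int (fib (m + 3)))"
  using d0_bar_Suc[of "2 * m + 1"] unfolding coeff_basis0 moment_basis0_diag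
  by (simp only: Suc_eq_plus1 add.assoc one_add_one)

lemma d0_bar_steps:
  "d0_bar (4 * n + 1) * int (fib (2 * n + 1)) = d0_bar (4 * n) * int (fib (2 * n + 2))"
  "d0_bar (4 * n + 2) = - d0_bar (4 * n + 1)"
  "d0_bar (4 * n + 3) * int (fib (2 * n + 2)) = - d0_bar (4 * n + 2) * int (fib (2 * n + 3))"
  "d0_bar (4 * n + 4) * int (fib (2 * n + 2)) = d0_bar (4 * n + 3) * int (fib (2 * n + 4))"
  using d0_bar_step_even[of "2 * n"] d0_bar_step_odd[of "2 * n"]
    d0_bar_step_even[of "2 * n + 1"] d0_bar_step_odd[of "2 * n + 1"]
  unfolding index_simps by (simp_all del: fib.simps)

lemma d1_bar_steps:
  "d1_bar (4 * n + 2) = - d1_bar (4 * n)"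
  "d1_bar (4 * n + 4) * (int (fib (2 * n + 2)))\<^sup>2 = - d1_bar (4 * n + 2) * (int (fib (2 * n + 4)))\<^sup>2"
  using d1_bar_even_Suc[of "2 * n"] d1_bar_even_Suc[of "2 * n + 1"]
  unfolding lead_coeff_shifted_poly moment_shifted_poly_diag index_simps
  by (simp_all del: fib.simps)

text \<open>Conditional on the value at \<open>4 * n\<close>, so that its last claim serves as the
  induction step for that value.\<close>

lemma d0_bar_values:
  assumes "d0_bar (4 * n) = int (fib (2 * n + 1) * fib (2 * n + 2))"
  shows "d0_bar (4 * n + 1) = int (fib (2 * n + 2) ^ 2)"
    and "d0_bar (4 * n + 2) = - int (fib (2 * n + 2) ^ 2)"
    and "d0_bar (4 * n + 3) = int (fib (2 * n + 2) * fib (2 * n + 3))"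
    and "d0_bar (4 * n + 4) = int (fib (2 * n + 3) * fib (2 * n + 4))"
proof -
  have nz: "int (fib (2 * n + 1)) \<noteq> 0" "int (fib (2 * n + 2)) \<noteq> 0"
    using fib_Suc_neq_0[of "2 * n"] fib_Suc_neq_0[of "2 * n + 1"] by simp_all
  have "d0_bar (4 * n + 1) * int (fib (2 * n + 1)) = int (fib (2 * n + 2) ^ 2) * int (fib (2 * n + 1))"
    using d0_bar_steps(1)[of n] assms by (simp add: power2_eq_square mult_ac del: fib.simps)
  then show 1: "d0_bar (4 * n + 1) = int (fib (2 * n + 2) ^ 2)" using nz by simp
  then show 2: "d0_bar (4 * n + 2) = - int (fib (2 * n + 2) ^ 2)" by (simp only: d0_bar_steps(2))
  have "d0_bar (4 * n + 3) * int (fib (2 * n + 2)) =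
      int (fib (2 * n + 2) * fib (2 * n + 3)) * int (fib (2 * n + 2))"
    using d0_bar_steps(3)[of n] 2 by (simp add: power2_eq_square mult_ac del: fib.simps)
  then show 3: "d0_bar (4 * n + 3) = int (fib (2 * n + 2) * fib (2 * n + 3))" using nz by simp
  have "d0_bar (4 * n + 4) * int (fib (2 * n + 2)) =
      int (fib (2 * n + 3) * fib (2 * n + 4)) * int (fib (2 * n + 2))"
    using d0_bar_steps(4)[of n] 3 by (simp add: mult_ac del: fib.simps)
  then show "d0_bar (4 * n + 4) = int (fib (2 * n + 3) * fib (2 * n + 4))" using nz by simp
qed

lemma d0_bar_4_times: "d0_bar (4 * n) = int (fib (2 * n + 1) * fib (2 * n + 2))"
proof (induction n)
  case 0
  show ?case by (simp add: d0_bar_0)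
next
  case (Suc n)
  from d0_bar_values(4)[OF Suc] show ?case by (simp only: index_simps)
qed

text \<open>Two steps flip the sign twice and multiply by the square of
  \<open>fib (2 * n + 4) / fib (2 * n + 2)\<close>.\<close>

lemma d1_bar_4_times: "d1_bar (4 * n) = int (fib (2 * n + 2) ^ 2)"
proof (induction n)
  case 0
  show ?case by (simp add: d1_bar_0)
next
  case (Suc n)
  have "int (fib (2 * n + 2)) \<noteq> 0"
    using fib_Suc_neq_0[of "2 * n + 1"] by (simp del: fib.simps)
  moreover have "d1_bar (4 * n + 4) * (int (fib (2 * n + 2)))\<^sup>2 =
      int (fib (2 * n + 4) ^ 2) * (int (fib (2 * n + 2)))\<^sup>2"
    using d1_bar_steps[of n] Suc by (simp add: mult_ac del: fib.simps)
  ultimately have "d1_bar (4 * n + 4) = int (fib (2 * n + 4) ^ 2)" by simp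
  then show ?case by (simp only: index_simps)
qed

theorem theorem2p3:
  fixes n :: nat
  shows "d0_bar (4 * n) = int (fib (2 * n + 1) * fib (2 * n + 2)) \<and>
         d0_bar (4 * n + 1) = int (fib (2 * n + 2) ^ 2) \<and>
         d0_bar (4 * n + 2) = - int (fib (2 * n + 2) ^ 2) \<and>
         d0_bar (4 * n + 3) = int (fib (2 * n + 2) * fib (2 * n + 3)) \<and>
         d1_bar (2 * n + 1) = 0 \<and>
         d1_bar (4 * n) = int (fib (2 * n + 2) ^ 2) \<and>
         d1_bar (4 * n + 2) = - int (fib (2 * n + 2) ^ 2)"
  using d0_bar_4_times[of n] d0_bar_values[OF d0_bar_4_times, of n] d1_bar_odd[of n]
    d1_bar_4_times[of n] d1_bar_steps(1)[of n]
  by (simp only: simp_thms)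

end
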